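(* Let $n\ge 1$, let $\Omega\subset\mathbb R^n$ be open and bounded, and let $0\le k<n$. Let $\mathbb P\Lambda^k(\Omega)\subset\Lambda^k(\Omega)$ and $\mathbb P\Lambda^{k+1}(\Omega)\subset\Lambda^{k+1}(\Omega)$ be finite-dimensional spaces of polynomial differential forms such that $d^k\,\mathbb P\Lambda^k(\Omega)\subset\mathbb P\Lambda^{k+1}(\Omega)$, and let $r=\dim \mathbb P\Lambda^k(\Omega)-\dim\operatorname{Ker}\bigl(d^k|_{\mathbb P\Lambda^k(\Omega)}\bigr)$. For $j=k,k+1$ let $\{\varphi^j_i\}_{i=1,\dots,\dim\mathbb P\Lambda^j(\Omega)}$ be a basis of $\mathbb P\Lambda^j(\Omega)$ and let $\{\mathcal N^j_i\}_{i=1,\dots,\dim\mathbb P\Lambda^j(\Omega)}$ be linear functionals on $\Lambda^j(\Omega)$ such that $\mathcal N^j_i(\varphi^j_m)=\delta_{im}$ for all $i,m$. Define $$I_j\colon\Lambda^j(\Omega)\to\mathbb P\Lambda^j(\Omega),\qquad I_j u=\sum_{i=1}^{\dim\mathbb P\Lambda^j(\Omega)}\mathcal N^j_i(u)\,\varphi^j_i,\qquad j=k,k+1.$$ Assume that $$d^k\varphi^k_i=\varphi^{k+1}_i\ \ (i=1,\dots,r),\qquad d^k\varphi^k_i=0\ \ (i=r+1,\dots,\dim\mathbb P\Lambda^k(\Omega)),$$ and that for every $u\in\Lambda^k(\Omega)$ $$\mathcal N^{k+1}_i(d^k u)=\mathcal N^k_i(u)\ \ (i=1,\dots,r),\qquad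 \mathcal N^{k+1}_i(d^ku)=0\ \ (i=r+1,\dots,\dim\mathbb P\Lambda^{k+1}(\Omega)).$$ Then $d^k I_k u=I_{k+1}d^k u$ for all $u\in\Lambda^k(\Omega)$.
   Context: $\Lambda^k(\Omega)$ denotes the space of smooth differential $k$-forms on $\Omega$ and $d^k\colon\Lambda^k(\Omega)\to\Lambda^{k+1}(\Omega)$ the exterior derivative. A polynomial differential form is one whose coefficient functions (with respect to $dx^{\sigma_1}\wedge\cdots\wedge dx^{\sigma_k}$) are polynomials. *)

theory Defs
  imports "HOL-Analysis.Analysis" "HOL-Library.Function_Algebras"
begin

text \<open>Pointwise real vector space structure on functions, so that \<open>subspace\<close>, \<open>span\<close>,
  \<open>independent\<close> and \<open>dim\<close> apply to spaces of differential forms.\<close>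

instantiation "fun" :: (type, real_vector) real_vector
begin

definition scaleR_fun :: "real \<Rightarrow> ('a \<Rightarrow> 'b) \<Rightarrow> 'a \<Rightarrow> 'b"
  where "scaleR_fun c f = (\<lambda>x. c *\<^sub>R f x)"

instance
  by standard (auto simp: scaleR_fun_def fun_eq_iff algebra_simps)

end

text \<open>For open \<open>S\<close> in a finite-dimensional space. Continuity of all directional derivatives is
  then continuity of the derivative.\<close>

primrec Ck_on :: "nat \<Rightarrow> 'a::euclidean_space set \<Rightarrow> ('a \<Rightarrow> real) \<Rightarrow> bool" where
  "Ck_on 0 S f \<longleftrightarrow> continuous_on S f"
| "Ck_on (Suc m) S f \<longleftrightarrow>
     (\<forall>x\<in>S. f differentiable (at x)) \<and> (\<forall>v. Ck_on m S (\<lambda>x. frechet_derivative f (at x) v))"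

definition smooth_on :: "'a::euclidean_space set \<Rightarrow> ('a \<Rightarrow> real) \<Rightarrow> bool"
  where "smooth_on S f \<longleftrightarrow> (\<forall>m. Ck_on m S f)"

text \<open>An alternating \<open>k\<close>-linear form takes a list of \<open>k\<close> vectors; it is \<open>0\<close> by convention on
  lists of any other length, so that equality of such functions is equality of forms.\<close>

definition alternating_form :: "nat \<Rightarrow> ((real^'n) list \<Rightarrow> real) \<Rightarrow> bool" where
  "alternating_form k a \<longleftrightarrow>
     (\<forall>vs. length vs \<noteq> k \<longrightarrow> a vs = 0) \<and>
     (\<forall>vs i. length vs = k \<longrightarrow> i < k \<longrightarrow> linear (\<lambda>w. a (vs[i := w]))) \<and>
     (\<forall>vs. length vs = k \<longrightarrow> \<not> distinct vs \<longrightarrow> a vs = 0)"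

type_synonym 'n diff_form = "real^'n \<Rightarrow> (real^'n) list \<Rightarrow> real"

text \<open>A form on \<open>\<Omega>\<close> is represented by its extension by \<open>0\<close> outside \<open>\<Omega>\<close>, so that equality of
  functions is equality of forms on \<open>\<Omega>\<close>. Smoothness is required on \<open>\<Omega>\<close> only.\<close>

definition smooth_forms :: "nat \<Rightarrow> (real^'n) set \<Rightarrow> 'n::finite diff_form set" where
  "smooth_forms k \<Omega> =
     {\<omega>. (\<forall>x\<in>\<Omega>. alternating_form k (\<omega> x)) \<and> (\<forall>x. x \<notin> \<Omega> \<longrightarrow> \<omega> x = 0) \<and>
         (\<forall>vs. smooth_on \<Omega> (\<lambda>x. \<omega> x vs))}"

text \<open>\<open>form_coeff \<omega> \<sigma>\<close> is the coefficient function of \<open>dx\<^bsup>\<sigma>\<^sub>1\<^esup> \<and> \<dots> \<and> dx\<^bsup>\<sigma>\<^sub>k\<^esup>\<close>. The index type carries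
  no order, so \<open>\<sigma>\<close> ranges over all index lists; rearranging \<open>\<sigma>\<close> only changes the sign of the
  coefficient, and a repeated index gives \<open>0\<close>.\<close>

definition form_coeff :: "'n::finite diff_form \<Rightarrow> 'n list \<Rightarrow> real^'n \<Rightarrow> real"
  where "form_coeff \<omega> \<sigma> x = \<omega> x (map (\<lambda>i. axis i 1) \<sigma>)"

definition polynomial_forms :: "nat \<Rightarrow> (real^'n) set \<Rightarrow> 'n::finite diff_form set" where
  "polynomial_forms k \<Omega> =
     {\<omega> \<in> smooth_forms k \<Omega>. \<forall>\<sigma>. length \<sigma> = k \<longrightarrow>
        (\<exists>p. real_polynomial_function p \<and> (\<forall>x\<in>\<Omega>. form_coeff \<omega> \<sigma> x = p x))}"

text \<open>The exterior derivative, evaluated on constant vector fields \<open>v\<^sub>0, \<dots>, v\<^sub>k\<close>: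
  \<open>(d\<omega>)\<^sub>x(v\<^sub>0, \<dots>, v\<^sub>k) = \<Sum>\<^sub>i (-1)\<^sup>i D\<^sub>x[\<omega>(v\<^sub>0, \<dots>, v\<^sub>i\<^sub>-\<^sub>1, v\<^sub>i\<^sub>+\<^sub>1, \<dots>, v\<^sub>k)](v\<^sub>i)\<close>.
  The degree need not be given: a \<open>k\<close>-form vanishes on lists of length other than \<open>k\<close>, so the
  value below vanishes on lists of length other than \<open>k + 1\<close>.\<close>

definition ext_deriv :: "(real^'n) set \<Rightarrow> 'n::finite diff_form \<Rightarrow> 'n diff_form" where
  "ext_deriv \<Omega> \<omega> = (\<lambda>x vs. if x \<in> \<Omega> then
     (\<Sum>i<length vs. (-1)^i *
        frechet_derivative (\<lambda>y. \<omega> y (take i vs @ drop (Suc i) vs)) (at x) (vs ! i)) else 0)"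

definition linear_functional_on :: "'a::real_vector set \<Rightarrow> ('a \<Rightarrow> real) \<Rightarrow> bool" where
  "linear_functional_on V N \<longleftrightarrow>
     (\<forall>u\<in>V. \<forall>w\<in>V. N (u + w) = N u + N w) \<and> (\<forall>c. \<forall>u\<in>V. N (c *\<^sub>R u) = c * N u)"

definition finite_dimensional :: "'a::real_vector set \<Rightarrow> bool"
  where "finite_dimensional V \<longleftrightarrow> (\<exists>B. finite B \<and> V \<subseteq> span B)"

definition interpolant ::
  "'a::real_vector set \<Rightarrow> (nat \<Rightarrow> 'a \<Rightarrow> real) \<Rightarrow> (nat \<Rightarrow> 'a) \<Rightarrow> 'a \<Rightarrow> 'a"
  where "interpolant P N \<phi> u = (\<Sum>i = 1..dim P. N i u *\<^sub>R \<phi> i)"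

end

theory Submission
  imports Defs
begin

text \<open>Both sides of the identity expand to \<open>\<Sum>\<^sub>i N\<^sub>i(u) \<phi>\<^sub>i\<close> over the first \<open>r\<close> basis elements of
  \<open>P (k + 1)\<close>: on the left because \<open>d\<close> kills the remaining basis elements of \<open>P k\<close>, on the right
  because the remaining functionals kill \<open>d u\<close>. That there are at least \<open>r\<close> basis elements in
  \<open>P (k + 1)\<close> is rank--nullity.\<close>

text \<open>Library facts about \<open>linear\<close> concern maps on the whole type, whereas
  \<open>ext_deriv\<close> behaves linearly only where derivatives exist. Prescribing the values on
  a basis of \<open>S\<close> gives a global linear map, and the set where it agrees with
  \<open>f\<close> is a subspace containing that basis.\<close>

lemma linear_extension_from_subspace:
  fixes f :: "'a::real_vector \<Rightarrow> 'b::real_vector"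
  assumes S: "subspace S"
    and add: "\<And>x y. x \<in> S \<Longrightarrow> y \<in> S \<Longrightarrow> f (x + y) = f x + f y"
    and scale: "\<And>c x. x \<in> S \<Longrightarrow> f (c *\<^sub>R x) = c *\<^sub>R f x"
  obtains g where "linear g" "\<And>x. x \<in> S \<Longrightarrow> g x = f x"
proof -
  obtain B where B: "B \<subseteq> S" "independent B" "S \<subseteq> span B"
    using real_vector.maximal_independent_subset by blast
  obtain g where g: "linear g" "\<And>x. x \<in> B \<Longrightarrow> g x = f x"
    using real_vector.linear_independent_extend[OF B(2), of f] by blast
  have f0: "f 0 = 0"
    using scale[OF subspace_0[OF S], of 0] by simp
  have "subspace {x \<in> S. g x = f x}"
    using S g(1) by (auto simp: subspace_def f0 add scale linear_0 linear_add linear_scale)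
  then have "span B \<subseteq> {x \<in> S. g x = f x}"
    using B(1) g(2) by (intro span_minimal) auto
  then show thesis
    using that[OF g(1)] B(3) by blast
qed

text \<open>The half of rank-nullity that bounds r by the dimension of the target: a basis
  \<open>B\<close> of the kernel, together with lifts of a basis \<open>E\<close> of the image,
  spans \<open>V\<close>.\<close>

lemma dim_le_dim_kernel_plus_card:
  fixes g :: "'a::real_vector \<Rightarrow> 'b::real_vector"
  assumes g: "linear g" and V: "subspace V" "finite_dimensional V"
    and C: "finite C" "g ` V \<subseteq> span C"
  shows "dim V \<le> dim {v \<in> V. g v = 0} + card C"
proof -
  obtain F where F: "finite F" "V \<subseteq> span F"
    using V(2) by (auto simp: finite_dimensional_def)
  obtain B where B: "B \<subseteq> {v \<in> V. g v = 0}" "independent B" "{v \<in> V. g v = 0} \<subseteq> span B"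
      "card B = dim {v \<in> V. g v = 0}"
    using real_vector.basis_exists by blast
  \<comment> \<open>\<open>card\<close> of an infinite set is 0, so counting with \<open>B\<close>
    is meaningful only once the finite spanning set \<open>F\<close> has bounded it.\<close>
  have finB: "finite B"
    using real_vector.independent_span_bound[OF F(1) B(2)] B(1) F(2) by blast
  obtain E where E: "E \<subseteq> g ` V" "independent E" "g ` V \<subseteq> span E"
    using real_vector.maximal_independent_subset by blast
  have finE: "finite E" "card E \<le> card C"
    using real_vector.independent_span_bound[OF C(1) E(2) subset_trans[OF E(1) C(2)]] by simp_all
  have "\<forall>e\<in>E. \<exists>v. v \<in> V \<and> g v = e"
    using E(1) by blast
  then obtain h where h: "\<And>e. e \<in> E \<Longrightarrow> h e \<in> V \<and> g (h e) = e"
    using bchoice[of E "\<lambda>e v. v \<in> V \<and> g v = e"] by blast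
  \<comment> \<open>\<open>s\<close> is a linear section of \<open>g\<close> over
    \<open>span E\<close>, obtained by lifting each basis vector of the image into
    \<open>V\<close>.\<close>
  obtain s where s: "linear s" "\<And>e. e \<in> E \<Longrightarrow> s e = h e"
    using real_vector.linear_independent_extend[OF E(2), of h] by blast
  have gs: "g (s y) = y" if "y \<in> span E" for y
  proof -
    have "subspace {y. g (s y) = y}"
      using g s(1) by (auto simp: subspace_def linear_0 linear_add linear_scale)
    then have "span E \<subseteq> {y. g (s y) = y}"
      using h s(2) by (intro span_minimal) auto
    with that show ?thesis by blast
  qed
  have s_span: "s y \<in> span (s ` E)" if "y \<in> span E" for y
    using that linear_span_image[OF s(1), of E] by blast
  have sE: "span (s ` E) \<subseteq> V"
    using h s(2) V(1) by (intro span_minimal) auto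
  have "V \<subseteq> span (B \<union> s ` E)"
  proof
    fix v assume v: "v \<in> V"
    have y: "g v \<in> span E"
      using v E(3) by blast
    have w: "s (g v) \<in> span (s ` E)"
      using s_span y by blast
    \<comment> \<open>Splitting: subtracting the lift of its own image moves \<open>v\<close> into
      the kernel, which \<open>B\<close> spans.\<close>
    have "v - s (g v) \<in> {v \<in> V. g v = 0}"
      using v w sE V(1) gs[OF y] g by (auto simp: linear_diff subspace_diff)
    then have "(v - s (g v)) + s (g v) \<in> span (B \<union> s ` E)"
      using B(3) w span_mono[of B "B \<union> s ` E"] span_mono[of "s ` E" "B \<union> s ` E"]
      by (intro span_add) auto
    then show "v \<in> span (B \<union> s ` E)" by simp
  qed
  then have "dim V \<le> card (B \<union> s ` E)"
    using finB finE by (intro real_vector.dim_le_card) auto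
  also have "\<dots> \<le> card B + card (s ` E)"
    by (rule card_Un_le)
  also have "\<dots> \<le> card B + card C"
    using card_image_le[OF finE(1), of s] finE(2) by simp
  finally show ?thesis
    using B(4) by simp
qed

text \<open>On differential forms that are merely differentiable, \<open>ext_deriv\<close> is already linear, and
  this class is visibly a subspace; for \<open>smooth_forms\<close> that would need closure of \<open>Ck_on\<close> under
  addition.\<close>

definition differentiable_forms :: "(real^'n) set \<Rightarrow> 'n::finite diff_form set" where
  "differentiable_forms \<Omega> = {\<omega>. \<forall>x\<in>\<Omega>. \<forall>vs. (\<lambda>y. \<omega> y vs) differentiable (at x)}"

lemma subspace_differentiable_forms: "subspace (differentiable_forms \<Omega>)"
  by (auto simp: subspace_def differentiable_forms_def scaleR_fun_def zero_fun_def plus_fun_def)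

lemma smooth_forms_subset_differentiable_forms: "smooth_forms k \<Omega> \<subseteq> differentiable_forms \<Omega>"
proof
  fix \<omega> assume "\<omega> \<in> smooth_forms k \<Omega>"
  then have "Ck_on (Suc 0) \<Omega> (\<lambda>x. \<omega> x vs)" for vs
    unfolding smooth_forms_def smooth_on_def by blast
  then show "\<omega> \<in> differentiable_forms \<Omega>"
    by (simp add: differentiable_forms_def)
qed

text \<open>\<open>frechet_derivative\<close> is an arbitrary choice where no derivative exists,
  hence the differentiability assumptions here and below.\<close>

lemma frechet_derivative_add:
  assumes "f differentiable (at x)" "g differentiable (at x)"
  shows "frechet_derivative (\<lambda>y. f y + g y) (at x) v
    = frechet_derivative f (at x) v + frechet_derivative g (at x) v"
  using frechet_derivative_at[OF has_derivative_add[OF assms[unfolded frechet_derivative_works]]]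
  by (simp add: fun_eq_iff)

lemma frechet_derivative_cmult:
  fixes c :: real
  assumes "f differentiable (at x)"
  shows "frechet_derivative (\<lambda>y. c * f y) (at x) v = c * frechet_derivative f (at x) v"
  using frechet_derivative_at
    [OF has_derivative_mult_right[OF assms[unfolded frechet_derivative_works]], of c]
  by (simp add: fun_eq_iff)

lemma ext_deriv_add:
  assumes "\<omega> \<in> differentiable_forms \<Omega>" "\<eta> \<in> differentiable_forms \<Omega>"
  shows "ext_deriv \<Omega> (\<omega> + \<eta>) = ext_deriv \<Omega> \<omega> + ext_deriv \<Omega> \<eta>"
  using assms
  by (auto simp: ext_deriv_def differentiable_forms_def fun_eq_iff frechet_derivative_add
      distrib_left sum.distrib)

lemma ext_deriv_scaleR:
  assumes "\<omega> \<in> differentiable_forms \<Omega>"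
  shows "ext_deriv \<Omega> (c *\<^sub>R \<omega>) = c *\<^sub>R ext_deriv \<Omega> \<omega>"
  using assms
  by (auto simp: ext_deriv_def differentiable_forms_def fun_eq_iff scaleR_fun_def
      frechet_derivative_cmult sum_distrib_left mult.left_commute)

theorem lemma3p1:
  fixes \<Omega> :: "(real^'n::finite) set"
    and k r :: nat
    and P :: "nat \<Rightarrow> 'n diff_form set"
    and \<phi> :: "nat \<Rightarrow> nat \<Rightarrow> 'n diff_form"
    and N :: "nat \<Rightarrow> nat \<Rightarrow> 'n diff_form \<Rightarrow> real"
  assumes "open \<Omega>" and "bounded \<Omega>"
    and "k < CARD('n)"
    and "\<And>j. j \<in> {k, k + 1} \<Longrightarrow>
           P j \<subseteq> polynomial_forms j \<Omega> \<and> subspace (P j) \<and> finite_dimensional (P j)"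
    and "ext_deriv \<Omega> ` P k \<subseteq> P (k + 1)"
    and "r = dim (P k) - dim {u \<in> P k. ext_deriv \<Omega> u = 0}"
    and "\<And>j. j \<in> {k, k + 1} \<Longrightarrow>
           inj_on (\<phi> j) {1..dim (P j)} \<and> independent (\<phi> j ` {1..dim (P j)}) \<and>
           span (\<phi> j ` {1..dim (P j)}) = P j"
    and "\<And>j i. j \<in> {k, k + 1} \<Longrightarrow> i \<in> {1..dim (P j)} \<Longrightarrow>
           linear_functional_on (smooth_forms j \<Omega>) (N j i)"
    and "\<And>j i m. j \<in> {k, k + 1} \<Longrightarrow> i \<in> {1..dim (P j)} \<Longrightarrow> m \<in> {1..dim (P j)} \<Longrightarrow>
           N j i (\<phi> j m) = (if i = m then 1 else 0)"
    and "\<And>i. i \<in> {1..r} \<Longrightarrow> ext_deriv \<Omega> (\<phi> k i) = \<phi> (k + 1) i"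
    and "\<And>i. i \<in> {r+1..dim (P k)} \<Longrightarrow> ext_deriv \<Omega> (\<phi> k i) = 0"
    and "\<And>u i. u \<in> smooth_forms k \<Omega> \<Longrightarrow> i \<in> {1..r} \<Longrightarrow>
           N (k + 1) i (ext_deriv \<Omega> u) = N k i u"
    and "\<And>u i. u \<in> smooth_forms k \<Omega> \<Longrightarrow> i \<in> {r+1..dim (P (k + 1))} \<Longrightarrow>
           N (k + 1) i (ext_deriv \<Omega> u) = 0"
  shows "\<forall>u \<in> smooth_forms k \<Omega>.
           ext_deriv \<Omega> (interpolant (P k) (N k) (\<phi> k) u)
             = interpolant (P (k + 1)) (N (k + 1)) (\<phi> (k + 1)) (ext_deriv \<Omega> u)"
proof
  fix u assume u: "u \<in> smooth_forms k \<Omega>"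
  note dphi = assms(10,11) and Nd = assms(12,13)
  \<comment> \<open>\<open>g\<close> stands in for d: it is linear everywhere and equals
    \<open>ext_deriv\<close> on differentiable forms, hence on \<open>P k\<close>.\<close>
  obtain g where g: "linear g" "\<And>\<omega>. \<omega> \<in> differentiable_forms \<Omega> \<Longrightarrow> g \<omega> = ext_deriv \<Omega> \<omega>"
    using linear_extension_from_subspace[of _ "ext_deriv \<Omega>",
        OF subspace_differentiable_forms ext_deriv_add ext_deriv_scaleR] by blast
  have P: "subspace (P k)" "finite_dimensional (P k)"
    and Pdiff: "P k \<subseteq> differentiable_forms \<Omega>"
    using assms(4)[of k] smooth_forms_subset_differentiable_forms[of k \<Omega>]
    by (auto simp: polynomial_forms_def)
  have gP: "g \<omega> = ext_deriv \<Omega> \<omega>" if "\<omega> \<in> P k" for \<omega>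
    using that Pdiff g(2) by blast
  have phi: "\<phi> k i \<in> P k" if "i \<in> {1..dim (P k)}" for i
    using assms(7)[of k] that span_base[of "\<phi> k i" "\<phi> k ` {1..dim (P k)}"] by auto
  \<comment> \<open>The image of \<open>P k\<close> under d lies in \<open>P (k + 1)\<close>, which
    is spanned by the forms \<open>\<phi> (k + 1) i\<close>.\<close>
  have "dim (P k) \<le> dim {v \<in> P k. g v = 0} + card (\<phi> (k + 1) ` {1..dim (P (k + 1))})"
    using assms(5) assms(7)[of "k + 1"] gP
    by (intro dim_le_dim_kernel_plus_card g P) auto
  also have "{v \<in> P k. g v = 0} = {v \<in> P k. ext_deriv \<Omega> v = 0}"
    using gP by auto
  also have "card (\<phi> (k + 1) ` {1..dim (P (k + 1))}) \<le> dim (P (k + 1))"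
    using card_image_le[of "{1..dim (P (k + 1))}" "\<phi> (k + 1)"] by simp
  \<comment> \<open>\<open>r\<close> is a difference of naturals, truncated at 0, so it is at most
    \<open>dim (P k)\<close> whatever the dimension of the kernel.\<close>
  finally have r: "r \<le> dim (P (k + 1))" "r \<le> dim (P k)"
    using assms(6) by linarith+
  let ?I = "\<lambda>j u. interpolant (P j) (N j) (\<phi> j) u"
  have "?I k u \<in> P k"
    unfolding interpolant_def using phi P(1) by (intro subspace_sum subspace_scale) auto
  then have "ext_deriv \<Omega> (?I k u) = g (?I k u)"
    using gP by simp
  also have "\<dots> = (\<Sum>i = 1..dim (P k). N k i u *\<^sub>R ext_deriv \<Omega> (\<phi> k i))"
    unfolding interpolant_def using gP phi
    by (simp add: linear_sum[OF g(1)] linear_scale[OF g(1)])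
  also have "\<dots> = (\<Sum>i = 1..r. N k i u *\<^sub>R ext_deriv \<Omega> (\<phi> k i))"
    using r(2) dphi(2) by (intro sum.mono_neutral_right) auto
  also have "\<dots> = (\<Sum>i = 1..r. N (k + 1) i (ext_deriv \<Omega> u) *\<^sub>R \<phi> (k + 1) i)"
    using dphi(1) Nd(1)[OF u] by (intro sum.cong) auto
  \<comment> \<open>Padding the sum with zero terms requires \<open>{1..r}\<close> to lie inside
    \<open>{1..dim (P (k + 1))}\<close>; this is where the rank bound enters.\<close>
  also have "\<dots> = ?I (k + 1) (ext_deriv \<Omega> u)"
    unfolding interpolant_def using r(1) Nd(2)[OF u] by (intro sum.mono_neutral_left) auto
  finally show "ext_deriv \<Omega> (?I k u) = ?I (k + 1) (ext_deriv \<Omega> u)" .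
qed

end
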